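(* Let $X>0$ and $Y$ be real random variables connected by $X=e^Y$, i.e. $Y=\log X$, and let $J,K\ge0$ be integers and $C$, $D>0$, $d=\log D$, $a_j\neq0$, $b_j$ ($1\le j\le J$), $a'_k\ne0$, $b'_k$ ($1\le k\le K$) be real constants. Let $F$ be the meromorphic function $$F(s)=C D^s\,\frac{\prod_{j=1}^J\Gamma(a_js+b_j)}{\prod_{k=1}^K\Gamma(a'_ks+b'_k)}=C e^{ds}\,\frac{\prod_{j=1}^J\Gamma(a_js+b_j)}{\prod_{k=1}^K\Gamma(a'_ks+b'_k)},$$ and let $\rho_+:=\min\{x>0: x\text{ is a pole of }F\}\in(0,\infty]$ and $\rho_-:=\max\{x<0:x\text{ is a pole of }F\}\in[-\infty,0)$, where $\rho_+=\infty$ [$\rho_-=-\infty$] if $F$ has no pole on $(0,\infty)$ [$(-\infty,0)$]. Then the following are equivalent: (i) $\mathbb E X^s=F(s)$ for all real $s$ in some interval of positive length. (ii) $\mathbb E X^s=F(s)$ for all complex $s$ in the strip $\rho_-<\operatorname{Re}s<\rho_+$. (iii) $\mathbb E e^{sY}=F(s)$ for all real $s$ in some interval of positive length. (iv) $\mathbb E e^{sY}=F(s)$ for all complex $s$ in the strip $\rho_-<\operatorname{Re}s<\rho_+$. (v) $\mathbb E e^{\mathrm i tY}=F(\mathrm i t)$ for all real $t\neq0$ in some interval $|t|<t_0$ with $t_0>0$. (vi) $\mathbb E e^{\mathrm i tY}=F(\mathrm i t)$ for all real $t$. In this case, further $\mathbb E X^s=\mathbb E e^{sY}=\infty$ for real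 $s$ with $s\le\rho_-$ or $s\ge\rho_+$; thus $$\{s\in\mathbb R:\mathbb E X^s<\infty\}=\{s\in\mathbb R:\mathbb E e^{sY}<\infty\}=(\rho_-,\rho_+).$$ Equivalently, $\rho_+=\sup\{s\ge0:\mathbb E X^s<\infty\}$ and $\rho_-=\inf\{s\le0:\mathbb E X^s<\infty\}$. Furthermore, $F(s)=\mathbb E X^s=\mathbb E e^{sY}\neq0$ when $\rho_-<\operatorname{Re}s<\rho_+$.
   Context: $F$ is regarded as a meromorphic function on $\mathbb C$ with removable singularities removed (so cancelled poles of the Gamma factors are not poles of $F$, and there $F$ is defined by continuity). An equality such as $\mathbb E X^s=F(s)$ at a point includes the assertion that the expectation is finite (absolutely convergent) and that $F$ has no pole there. *)

theory Defs
  imports "HOL-Probability.Probability" "HOL-Complex_Analysis.Complex_Analysis"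
begin

text \<open>
  The value of the inner function at a pole of one of the Gamma factors is immaterial:
  \<open>remove_sings\<close> only looks at limits over punctured neighbourhoods, fills in removable
  singularities by continuity, and assigns the dummy value 0 at genuine poles.
\<close>
definition gamma_type_fun ::
  "real \<Rightarrow> real \<Rightarrow> nat \<Rightarrow> (nat \<Rightarrow> real) \<Rightarrow> (nat \<Rightarrow> real) \<Rightarrow>
   nat \<Rightarrow> (nat \<Rightarrow> real) \<Rightarrow> (nat \<Rightarrow> real) \<Rightarrow> complex \<Rightarrow> complex" where
  "gamma_type_fun C D J a b K a' b' =
     remove_sings (\<lambda>s. of_real C * of_real D powr s *
       (\<Prod>j=1..J. Gamma (of_real (a j) * s + of_real (b j))) /
       (\<Prod>k=1..K. Gamma (of_real (a' k) * s + of_real (b' k))))"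

lemma gamma_type_fun_exp:
  assumes "D > 0"
  shows "gamma_type_fun C D J a b K a' b' =
     remove_sings (\<lambda>s. of_real C * exp (of_real (ln D) * s) *
       (\<Prod>j=1..J. Gamma (of_real (a j) * s + of_real (b j))) /
       (\<Prod>k=1..K. Gamma (of_real (a' k) * s + of_real (b' k))))"
  using assms by (simp add: gamma_type_fun_def powr_def Ln_of_real mult.commute)

definition rho_plus :: "(complex \<Rightarrow> complex) \<Rightarrow> ereal" where
  "rho_plus F = (if \<exists>x>0. is_pole F (complex_of_real x)
     then ereal (LEAST x. x > 0 \<and> is_pole F (complex_of_real x)) else \<infinity>)"

definition rho_minus :: "(complex \<Rightarrow> complex) \<Rightarrow> ereal" where
  "rho_minus F = (if \<exists>x<0. is_pole F (complex_of_real x)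
     then ereal (GREATEST x. x < 0 \<and> is_pole F (complex_of_real x)) else - \<infinity>)"

text \<open>
  ``The expectation of \<open>Z\<close> equals \<open>F(s)\<close>'', including the assertions that the expectation
  converges absolutely and that \<open>s\<close> is not a pole of \<open>F\<close>.  Both are needed: a Bochner integral
  that does not exist and the value of \<open>F\<close> at a pole are both 0 by convention.
\<close>
definition expectation_eq_at ::
  "'a measure \<Rightarrow> ('a \<Rightarrow> complex) \<Rightarrow> (complex \<Rightarrow> complex) \<Rightarrow> complex \<Rightarrow> bool" where
  "expectation_eq_at M Z F s \<longleftrightarrow>
     integrable M Z \<and> \<not> is_pole F s \<and> (\<integral>\<omega>. Z \<omega> \<partial>M) = F s"

definition power_moment_eq ::
  "'a measure \<Rightarrow> ('a \<Rightarrow> real) \<Rightarrow> (complex \<Rightarrow> complex) \<Rightarrow> complex \<Rightarrow> bool" where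
  "power_moment_eq M X F s \<longleftrightarrow> expectation_eq_at M (\<lambda>\<omega>. complex_of_real (X \<omega>) powr s) F s"

definition exp_moment_eq ::
  "'a measure \<Rightarrow> ('a \<Rightarrow> real) \<Rightarrow> (complex \<Rightarrow> complex) \<Rightarrow> complex \<Rightarrow> bool" where
  "exp_moment_eq M Y F s \<longleftrightarrow> expectation_eq_at M (\<lambda>\<omega>. exp (s * complex_of_real (Y \<omega>))) F s"

end

theory Submission
  imports Defs
begin

text \<open>
  The set of real \<open>s\<close> with \<open>E exp (s Y) < \<infinity>\<close> is an interval around 0, and on the
  interior of the corresponding strip the transform \<open>\<phi> s = E exp (s Y)\<close> is analytic.  If it agrees with
  \<open>F\<close> somewhere it is the restriction of \<open>F\<close>.  The transform is finite at an end point only if \<open>F\<close>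
  stays bounded there, and \<open>F\<close> is regular at an end point only if the interval continues beyond it.
  So the interval is open and ends at poles of \<open>F\<close>, which identifies it with \<open>(\<rho>\<^sub>-, \<rho>\<^sub>+)\<close>.

  The second implication is Landau's theorem.  Both it and the passage from the imaginary axis
  to a strip rest on one fact: if \<open>E (w exp (i t Y))\<close> is for small \<open>t\<close> the value at \<open>i t\<close> of a function
  \<open>f\<close> analytic on the disc of radius \<open>R\<close>, then by Fatou's lemma applied to second differences
  \<open>E (w Y\<^bsup>2n\<^esup>)\<close> is finite and equals the \<open>2n\<close>-th derivative of \<open>f\<close> at 0, so
  \<open>E (w cosh (r Y))\<close> is dominated by the Taylor series of \<open>f\<close> for \<open>r < R\<close>.

  Finally, \<open>F\<close> has no zeros in the strip: off the real axis because Gamma has neither zeros nor poles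
  there, on it because \<open>E exp (s Y) > 0\<close>.
\<close>

section \<open>Second differences and even moments\<close>

text \<open>Adding the Taylor expansions at \<open>z + h\<close> and \<open>z - h\<close> cancels
  the first-order terms. The third derivative is bounded on a compact disc, so the cubic remainders
  leave an error of order \<open>norm h\<close> after the division.\<close>

lemma second_difference_quotient_tendsto:
  assumes "f analytic_on {z}"
  shows "((\<lambda>h. (f (z + h) + f (z - h) - 2 * f z) / h\<^sup>2) \<longlongrightarrow> deriv (deriv f) z) (at 0)"
proof -
  obtain R where R: "R > 0" "f holomorphic_on ball z R"
    using assms unfolding analytic_on_def by auto
  define r where "r = R / 2"
  have r: "r > 0" "cball z r \<subseteq> ball z R" using R by (auto simp: r_def)
  have hol: "(deriv ^^ n) f holomorphic_on ball z R" for n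
    using R by (intro holomorphic_higher_deriv) auto
  have "continuous_on (cball z r) ((deriv ^^ 3) f)"
    using hol[of 3] r by (meson holomorphic_on_imp_continuous_on holomorphic_on_subset)
  then have "bounded ((deriv ^^ 3) f ` cball z r)"
    by (intro compact_imp_bounded compact_continuous_image) auto
  then obtain B where B: "\<And>x. x \<in> cball z r \<Longrightarrow> norm ((deriv ^^ 3) f x) \<le> B"
    unfolding bounded_iff by blast
  have Taylor: "norm (f (z + h) - (f z + deriv f z * h + deriv (deriv f) z * h\<^sup>2 / 2)) \<le> B * norm h ^ 3 / 2"
    if "norm h \<le> r" for h
  proof -
    have "norm ((deriv ^^ 0) f (z + h) - (\<Sum>i\<le>2. (deriv ^^ i) f z * (z + h - z) ^ i / fact i))
        \<le> B * norm (z + h - z) ^ Suc 2 / fact 2"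
    proof (rule complex_Taylor[where S = "cball z r"])
      fix i x assume "x \<in> cball z r"
      then have "x \<in> ball z R" using r by auto
      then have "((deriv ^^ i) f has_field_derivative deriv ((deriv ^^ i) f) x) (at x)"
        using hol[of i] by (intro holomorphic_derivI) auto
      then show "((deriv ^^ i) f has_field_derivative (deriv ^^ Suc i) f x) (at x within cball z r)"
        by (auto intro: DERIV_subset)
    next
      fix x assume "x \<in> cball z r"
      then show "norm ((deriv ^^ Suc 2) f x) \<le> B"
        using B[of x] by (simp add: numeral_3_eq_3 numeral_2_eq_2)
    qed (use that r in \<open>auto simp: dist_norm\<close>)
    then show ?thesis
      by (simp add: numeral_3_eq_3 numeral_2_eq_2)
  qed
  have bound: "norm ((f (z + h) + f (z - h) - 2 * f z) / h\<^sup>2 - deriv (deriv f) z) \<le> B * norm h"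
    if h: "norm h \<le> r" "h \<noteq> 0" for h
  proof -
    have "norm (f (z + h) + f (z - h) - 2 * f z - deriv (deriv f) z * h\<^sup>2)
        = norm ((f (z + h) - (f z + deriv f z * h + deriv (deriv f) z * h\<^sup>2 / 2)) +
                (f (z + -h) - (f z + deriv f z * -h + deriv (deriv f) z * (-h)\<^sup>2 / 2)))"
      by (rule arg_cong[where f = norm]) (simp add: algebra_simps)
    also have "\<dots> \<le> B * norm h ^ 3 / 2 + B * norm (-h) ^ 3 / 2"
      using h by (intro norm_triangle_mono Taylor) auto
    also have "\<dots> = B * norm h * norm (h\<^sup>2)"
      by (simp add: norm_mult power2_eq_square power3_eq_cube)
    finally have "norm (f (z + h) + f (z - h) - 2 * f z - deriv (deriv f) z * h\<^sup>2) / norm (h\<^sup>2) \<le> B * norm h"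
      using h by (simp add: field_simps)
    moreover have "(f (z + h) + f (z - h) - 2 * f z) / h\<^sup>2 - deriv (deriv f) z
        = (f (z + h) + f (z - h) - 2 * f z - deriv (deriv f) z * h\<^sup>2) / h\<^sup>2"
      using h by (simp add: field_simps)
    ultimately show ?thesis
      by (simp only: norm_divide)
  qed
  have "((\<lambda>h. (f (z + h) + f (z - h) - 2 * f z) / h\<^sup>2 - deriv (deriv f) z) \<longlongrightarrow> 0) (at 0)"
  proof (rule Lim_null_comparison)
    show "\<forall>\<^sub>F h in at 0. norm ((f (z + h) + f (z - h) - 2 * f z) / h\<^sup>2 - deriv (deriv f) z) \<le> B * norm h"
      unfolding eventually_at using r bound by (auto intro!: exI[of _ r] simp: less_imp_le)
    show "((\<lambda>h. B * norm h) \<longlongrightarrow> 0) (at (0::complex))"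
      by (auto intro!: tendsto_eq_intros)
  qed
  then show ?thesis
    by (simp add: LIM_zero_iff)
qed

text \<open>The expression equals \<open>2 * cos x - 2\<close>, minus four times the square of
  \<open>sin (x / 2)\<close>. Taken at \<open>x = h * Y\<close> and divided by the square of
  \<open>h\<close>, the bound no longer depends on \<open>h\<close>, as dominated convergence
  requires.\<close>

lemma norm_second_difference_exp_le:
  fixes x :: real
  shows "norm (exp (\<i> * of_real x) + exp (- (\<i> * of_real x)) - 2) \<le> x\<^sup>2"
proof -
  have "exp (\<i> * of_real x) + exp (- (\<i> * of_real x)) - 2 = of_real (2 * cos x - 2)"
    by (simp add: complex_eq_iff Re_exp Im_exp)
  moreover have "\<bar>2 * cos x - 2\<bar> \<le> x\<^sup>2"
  proof -
    have "2 - 2 * cos x = 4 * (sin (x / 2))\<^sup>2"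
      using cos_double_sin[of "x / 2"] by simp
    moreover have "(sin (x / 2))\<^sup>2 \<le> (x / 2)\<^sup>2"
      using abs_sin_x_le_abs_x[of "x / 2"] by (simp only: abs_le_square_iff)
    ultimately show ?thesis
      using cos_le_one[of x] by (simp add: power_divide abs_le_iff)
  qed
  ultimately show ?thesis by (simp only: norm_of_real)
qed

text \<open>At \<open>t = 0\<close> the second difference quotients of the integrand are nonnegative
  and tend to \<open>w * Y^2\<close>, while their integrals tend to the second derivative of
  \<open>f\<close>, so Fatou's lemma makes \<open>w * Y^2\<close> integrable. It then dominates the
  quotients at every \<open>t\<close>, and dominated convergence identifies its transform.\<close>

lemma second_moment_of_analytic_transform:
  fixes w Y :: "'a \<Rightarrow> real" and f :: "complex \<Rightarrow> complex"
  assumes w: "integrable M w" "\<And>x. w x \<ge> 0" and Y [measurable]: "Y \<in> borel_measurable M"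
    and f: "f analytic_on ball 0 R"
    and eq: "\<And>t. \<bar>t\<bar> < R \<Longrightarrow> (LINT x|M. of_real (w x) * exp (\<i> * of_real t * of_real (Y x))) = f (\<i> * of_real t)"
    and R: "R > 0"
  shows "integrable M (\<lambda>x. w x * (Y x)\<^sup>2)"
    and "\<And>t. \<bar>t\<bar> < R \<Longrightarrow> (LINT x|M. of_real (w x * (Y x)\<^sup>2) * exp (\<i> * of_real t * of_real (Y x)))
           = deriv (deriv f) (\<i> * of_real t)"
proof -
  have wm [measurable]: "w \<in> borel_measurable M" using w by auto
  define h :: "nat \<Rightarrow> real" where "h n = 1 / Suc n" for n
  have h0: "h \<longlonglongrightarrow> 0" unfolding h_def by (rule LIMSEQ_Suc) (rule lim_1_over_n)
  have hpos: "h n > 0" for n by (simp add: h_def)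
  have lim_h: "filterlim (\<lambda>n. \<i> * of_real (h n)) (at 0) sequentially"
    unfolding filterlim_at using h0 hpos by (auto intro!: tendsto_eq_intros simp: less_imp_neq[THEN not_sym])
  \<comment> \<open>The increment is imaginary, so the integrals converge to the complex second
    derivative of \<open>f\<close>; the square of \<open>\<i>\<close> turns
    \<open>2 * cos - 2\<close> into a nonnegative quotient at \<open>t = 0\<close>.\<close>
  define q where "q t n x = of_real (w x) * ((exp (\<i> * of_real (t + h n) * of_real (Y x)) + exp (\<i> * of_real (t - h n) * of_real (Y x))
       - 2 * exp (\<i> * of_real t * of_real (Y x))) / (\<i> * of_real (h n))\<^sup>2)" for t n x
  have q_meas [measurable]: "q t n \<in> borel_measurable M" for t n
    unfolding q_def by measurable
  have int: "integrable M (\<lambda>x. of_real (w x) * exp (\<i> * of_real t * of_real (Y x)))" for t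
    by (rule Bochner_Integration.integrable_bound[OF w(1)]) (auto simp: norm_mult w(2))
  have q_eq: "q t n = (\<lambda>x. (of_real (w x) * exp (\<i> * of_real (t + h n) * of_real (Y x)) + of_real (w x) * exp (\<i> * of_real (t - h n) * of_real (Y x))
       - 2 * (of_real (w x) * exp (\<i> * of_real t * of_real (Y x)))) / (\<i> * of_real (h n))\<^sup>2)" for t n
    unfolding q_def by (intro ext) (simp add: ring_distribs)
  have q_int: "integrable M (q t n)" for t n
    unfolding q_eq by (intro integrable_divide_zero impI Bochner_Integration.integrable_diff Bochner_Integration.integrable_add integrable_mult_right int)
  have q_LINT: "integral\<^sup>L M (q t n) = ((LINT x|M. of_real (w x) * exp (\<i> * of_real (t + h n) * of_real (Y x))) 
      + (LINT x|M. of_real (w x) * exp (\<i> * of_real (t - h n) * of_real (Y x)))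
       - 2 * (LINT x|M. of_real (w x) * exp (\<i> * of_real t * of_real (Y x)))) / (\<i> * of_real (h n))\<^sup>2" for t n
    unfolding q_eq
    by (simp only: Bochner_Integration.integral_diff Bochner_Integration.integral_add integral_mult_right_zero
          integral_divide_zero int integrable_mult_right Bochner_Integration.integrable_add)
  have q_lim_integral: "(\<lambda>n. integral\<^sup>L M (q t n)) \<longlonglongrightarrow> deriv (deriv f) (\<i> * of_real t)" if t: "\<bar>t\<bar> < R" for t
  proof -
    have an: "f analytic_on {\<i> * of_real t}"
      using f by (rule analytic_on_subset) (use t in \<open>auto simp: norm_mult\<close>)
    note lim = filterlim_compose[OF second_difference_quotient_tendsto[OF an] lim_h]
    \<comment> \<open>Both shifted points must stay where the transform is known to equal
      \<open>f\<close>.\<close>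
    have "eventually (\<lambda>n. h n < R - \<bar>t\<bar>) sequentially"
      using h0 t by (intro order_tendstoD(2)) auto
    then have "eventually (\<lambda>n. (f (\<i> * of_real t + \<i> * of_real (h n)) + f (\<i> * of_real t - \<i> * of_real (h n)) - 2 * f (\<i> * of_real t)) / (\<i> * of_real (h n))\<^sup>2
        = integral\<^sup>L M (q t n)) sequentially"
    proof eventually_elim
      case (elim n)
      then have "\<bar>t + h n\<bar> < R" "\<bar>t - h n\<bar> < R" "\<bar>t\<bar> < R" using hpos[of n] by auto
      then show ?case unfolding q_LINT by (simp only: eq) (simp add: ring_distribs)
    qed
    with lim show ?thesis by (rule Lim_transform_eventually)
  qed
  have q_lim: "(\<lambda>n. q t n x) \<longlonglongrightarrow> of_real (w x * (Y x)\<^sup>2) * exp (\<i> * of_real t * of_real (Y x))" for t x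
  proof -
    let ?g = "\<lambda>z. exp (z * complex_of_real (Y x))"
    have d1: "deriv ?g = (\<lambda>z. exp (z * of_real (Y x)) * of_real (Y x))"
      by (intro ext DERIV_imp_deriv) (auto intro!: derivative_eq_intros)
    have "deriv (\<lambda>z. exp (z * complex_of_real (Y x)) * of_real (Y x)) (\<i> * of_real t) = (of_real (Y x))\<^sup>2 * exp (\<i> * of_real t * of_real (Y x))"
      by (intro DERIV_imp_deriv) (auto intro!: derivative_eq_intros simp: power2_eq_square)
    then have d2: "deriv (deriv ?g) (\<i> * of_real t) = (of_real (Y x))\<^sup>2 * exp (\<i> * of_real t * of_real (Y x))"
      unfolding d1 .
    have "?g analytic_on {\<i> * of_real t}" by (intro analytic_intros)
    from tendsto_mult_left[OF filterlim_compose[OF second_difference_quotient_tendsto[OF this] lim_h], of "of_real (w x)"]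
    show ?thesis unfolding d2 q_def by (simp add: ring_distribs mult.assoc)
  qed
  have q_bound: "norm (q t n x) \<le> w x * (Y x)\<^sup>2" for t n x
  proof -
    \<comment> \<open>Pulling out a factor of modulus 1 reduces the quotient at \<open>t\<close> to
      the one at 0, so the bound is uniform in \<open>t\<close> and \<open>n\<close>.\<close>
    have "exp (\<i> * of_real (t + h n) * of_real (Y x)) + exp (\<i> * of_real (t - h n) * of_real (Y x))
       - 2 * exp (\<i> * of_real t * of_real (Y x)) = exp (\<i> * of_real t * of_real (Y x)) *
        (exp (\<i> * of_real (h n * Y x)) + exp (- (\<i> * of_real (h n * Y x))) - 2)"
      by (simp add: ring_distribs exp_add exp_diff exp_minus divide_inverse mult.assoc)
    then have "norm (q t n x) = w x * (norm (exp (\<i> * of_real (h n * Y x)) + exp (- (\<i> * of_real (h n * Y x))) - 2) / (h n)\<^sup>2)"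
      unfolding q_def by (simp add: norm_mult norm_divide norm_power w(2))
    also have "\<dots> \<le> w x * ((h n * Y x)\<^sup>2 / (h n)\<^sup>2)"
      by (intro mult_left_mono divide_right_mono norm_second_difference_exp_le w(2)) auto
    also have "\<dots> = w x * (Y x)\<^sup>2" using hpos[of n] by (simp add: power_mult_distrib)
    finally show ?thesis .
  qed
  have q_real: "norm (q 0 n x) = Re (q 0 n x)" for n x
  proof -
    have "q 0 n x = of_real (w x * ((2 - 2 * cos (h n * Y x)) / (h n)\<^sup>2))"
      unfolding q_def using hpos[of n]
      by (simp add: complex_eq_iff Re_exp Im_exp power_mult_distrib field_simps)
    moreover have "w x * ((2 - 2 * cos (h n * Y x)) / (h n)\<^sup>2) \<ge> 0"
      using w(2)[of x] by (intro mult_nonneg_nonneg divide_nonneg_nonneg) auto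
    ultimately show ?thesis by (simp only: norm_of_real Re_complex_of_real abs_of_nonneg)
  qed
  show int2: "integrable M (\<lambda>x. w x * (Y x)\<^sup>2)"
  proof (rule integrableI_bounded)
    have "(\<integral>\<^sup>+x. ennreal (norm (w x * (Y x)\<^sup>2)) \<partial>M) = (\<integral>\<^sup>+x. liminf (\<lambda>n. ennreal (norm (q 0 n x))) \<partial>M)"
    proof (rule nn_integral_cong)
      fix x
      have "(\<lambda>n. ennreal (norm (q 0 n x))) \<longlonglongrightarrow> ennreal (norm (w x * (Y x)\<^sup>2))"
        using tendsto_norm[OF q_lim[of 0 x]] by (intro tendsto_ennrealI) (simp add: norm_mult norm_power abs_mult)
      then show "ennreal (norm (w x * (Y x)\<^sup>2)) = liminf (\<lambda>n. ennreal (norm (q 0 n x)))"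
        by (intro lim_imp_Liminf[symmetric]) auto
    qed
    also have "\<dots> \<le> liminf (\<lambda>n. \<integral>\<^sup>+x. ennreal (norm (q 0 n x)) \<partial>M)"
      by (rule nn_integral_liminf) measurable
    \<comment> \<open>Nonnegativity of \<open>q 0 n\<close> makes its L1 norm equal to its integral,
      and these integrals converge.\<close>
    also have "(\<lambda>n. \<integral>\<^sup>+x. ennreal (norm (q 0 n x)) \<partial>M) = (\<lambda>n. ennreal (Re (integral\<^sup>L M (q 0 n))))"
    proof
      fix n
      have "(\<integral>\<^sup>+x. ennreal (norm (q 0 n x)) \<partial>M) = ennreal (LINT x|M. norm (q 0 n x))"
        by (intro nn_integral_eq_integral integrable_norm q_int) auto
      also have "(LINT x|M. norm (q 0 n x)) = Re (integral\<^sup>L M (q 0 n))"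
        unfolding q_real using q_int by simp
      finally show "(\<integral>\<^sup>+x. ennreal (norm (q 0 n x)) \<partial>M) = ennreal (Re (integral\<^sup>L M (q 0 n)))" .
    qed
    also have "liminf \<dots> = ennreal (Re (deriv (deriv f) 0))"
      using q_lim_integral[of 0] R by (intro lim_imp_Liminf tendsto_ennrealI tendsto_Re) auto
    finally show "(\<integral>\<^sup>+x. ennreal (norm (w x * (Y x)\<^sup>2)) \<partial>M) < \<infinity>"
      using ennreal_less_top le_less_trans by fastforce
  qed measurable
  fix t assume t: "\<bar>t\<bar> < R"
  have "(\<lambda>n. integral\<^sup>L M (q t n)) \<longlonglongrightarrow> (LINT x|M. of_real (w x * (Y x)\<^sup>2) * exp (\<i> * of_real t * of_real (Y x)))"
    by (rule integral_dominated_convergence[OF _ _ int2]) (use q_lim q_bound in auto)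
  then show "(LINT x|M. of_real (w x * (Y x)\<^sup>2) * exp (\<i> * of_real t * of_real (Y x))) = deriv (deriv f) (\<i> * of_real t)"
    using q_lim_integral[OF t] LIMSEQ_unique by blast
qed

text \<open>\<open>w * Y ^ (2 * n)\<close> is again a nonnegative integrable weight with an analytic
  transform, so the second-moment step iterates. Odd powers would lose the sign on which Fatou's
  lemma rests.\<close>

lemma even_moments_of_analytic_transform:
  fixes w Y :: "'a \<Rightarrow> real" and f :: "complex \<Rightarrow> complex"
  assumes w: "integrable M w" "\<And>x. w x \<ge> 0" and Y: "Y \<in> borel_measurable M"
    and f: "f analytic_on ball 0 R"
    and eq: "\<And>t. \<bar>t\<bar> < R \<Longrightarrow> (LINT x|M. of_real (w x) * exp (\<i> * of_real t * of_real (Y x))) = f (\<i> * of_real t)"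
    and R: "R > 0"
  shows "integrable M (\<lambda>x. w x * Y x ^ (2 * n)) \<and>
    (\<forall>t. \<bar>t\<bar> < R \<longrightarrow> (LINT x|M. of_real (w x * Y x ^ (2 * n)) * exp (\<i> * of_real t * of_real (Y x)))
           = (deriv ^^ (2 * n)) f (\<i> * of_real t))"
proof (induction n)
  case 0
  then show ?case using w eq by simp
next
  case (Suc n)
  have an: "(deriv ^^ (2 * n)) f analytic_on ball 0 R"
    using f by (rule analytic_higher_deriv)
  note step = second_moment_of_analytic_transform[OF _ _ Y an _ R, of "\<lambda>x. w x * Y x ^ (2 * n)"]
  have eqs: "w x * Y x ^ (2 * Suc n) = w x * Y x ^ (2 * n) * (Y x)\<^sup>2"
    "(deriv ^^ (2 * Suc n)) f = deriv (deriv ((deriv ^^ (2 * n)) f))" for x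
    by (simp_all add: power2_eq_square)
  have "w x * Y x ^ (2 * n) \<ge> 0" for x
    using w(2)[of x] by (simp add: zero_le_even_power)
  then show ?case
    unfolding eqs using step Suc.IH by blast
qed

section \<open>Exponential integrability and power series of transforms\<close>

text \<open>The even moments are even-order derivatives of \<open>f\<close> at 0, so termwise
  integration of the cosh series is controlled by the Taylor series of \<open>f\<close>, which
  converges absolutely for \<open>\<bar>r\<bar> < R\<close>. Derivatives at 0 are local, so
  agreement for \<open>\<bar>t\<bar> < d\<close> gives integrability up to the full radius
  \<open>R\<close>, however small \<open>d\<close> is.\<close>

lemma exp_integrable_of_analytic_transform:
  fixes w Y :: "'a \<Rightarrow> real" and f :: "complex \<Rightarrow> complex"
  assumes w: "integrable M w" "\<And>x. w x \<ge> 0" and Y [measurable]: "Y \<in> borel_measurable M"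
    and f: "f analytic_on ball 0 R"
    and eq: "\<And>t. \<bar>t\<bar> < d \<Longrightarrow> (LINT x|M. of_real (w x) * exp (\<i> * of_real t * of_real (Y x))) = f (\<i> * of_real t)"
    and d: "d > 0" and r: "\<bar>r\<bar> < R"
  shows "integrable M (\<lambda>x. w x * exp (r * Y x))"
proof -
  have wm [measurable]: "w \<in> borel_measurable M" using w by auto
  have R0: "R > 0" using r by linarith
  have "f analytic_on ball 0 (min d R)"
    using f by (rule analytic_on_subset) auto
  note moments = even_moments_of_analytic_transform[OF w Y this eq]
  have moment: "integrable M (\<lambda>x. w x * Y x ^ n)" "of_real (LINT x|M. w x * Y x ^ n) = (deriv ^^ n) f 0"
    if ev: "even n" for n
  proof -
    obtain k where k: "n = 2 * k" using ev by (rule evenE)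
    have "\<forall>t. \<bar>t\<bar> < min d R \<longrightarrow> (LINT x|M. of_real (w x * Y x ^ n) * exp (\<i> * of_real t * of_real (Y x)))
        = (deriv ^^ n) f (\<i> * of_real t)"
      unfolding k using moments[of k] d R0 by auto
    from this[rule_format, of 0] have "(LINT x|M. complex_of_real (w x * Y x ^ n)) = (deriv ^^ n) f 0"
      using d R0 by simp
    then show "of_real (LINT x|M. w x * Y x ^ n) = (deriv ^^ n) f 0"
      by (simp only: integral_complex_of_real)
    show "integrable M (\<lambda>x. w x * Y x ^ n)"
      unfolding k using moments[of k] d R0 by auto
  qed
  \<comment> \<open>Zeros at odd indices align the cosh series index by index with the Taylor series
    of \<open>f\<close>.\<close>
  define c where "c n x = (if even n then w x * ((r * Y x) ^ n /\<^sub>R fact n) else 0)" for n x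
  have c_sums: "(\<lambda>n. c n x) sums (w x * cosh (r * Y x))" for x
    using sums_mult[OF cosh_converges[of "r * Y x"], of "w x"] by (rule sums_cong[THEN iffD1, rotated]) (simp add: c_def)
  have c_nonneg: "c n x \<ge> 0" for n x
    unfolding c_def using w(2)[of x] by (auto intro!: mult_nonneg_nonneg zero_le_even_power)
  have c_eq: "c n = (\<lambda>x. (r ^ n / fact n) * (w x * Y x ^ n))" if "even n" for n
    using that by (auto simp: c_def fun_eq_iff power_mult_distrib field_simps)
  have c_odd: "c n = (\<lambda>x. 0)" if "odd n" for n
    using that by (auto simp: c_def)
  have c_int: "integrable M (c n)" for n
    by (cases "even n") (simp_all add: c_eq c_odd moment)
  \<comment> \<open>Convergence at a point of modulus strictly between \<open>\<bar>r\<bar>\<close>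
    and \<open>R\<close> gives absolute convergence at \<open>r\<close>.\<close>
  have "complex_of_real ((\<bar>r\<bar> + R) / 2) \<in> ball 0 R"
    using r by (simp add: norm_divide) (smt (verit) norm_of_real of_real_add field_sum_of_halves)
  from holomorphic_power_series[OF analytic_imp_holomorphic[OF f] this]
  have "summable (\<lambda>n. (deriv ^^ n) f 0 / fact n * of_real ((\<bar>r\<bar> + R) / 2) ^ n)"
    by (simp add: sums_iff)
  then have sum: "summable (\<lambda>n. norm ((deriv ^^ n) f 0 / fact n * of_real r ^ n))"
    by (rule powser_insidea) (use r in \<open>auto simp del: of_real_divide of_real_add\<close>)
  have "integrable M (\<lambda>x. \<Sum>n. c n x)"
  proof (rule integrable_suminf[OF c_int])
    show "AE x in M. summable (\<lambda>n. norm (c n x))"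
      using c_nonneg c_sums by (auto simp: sums_iff)
    show "summable (\<lambda>n. LINT x|M. norm (c n x))"
    proof (rule summable_comparison_test'[OF sum])
      fix n :: nat
      have "norm (LINT x|M. norm (c n x)) = (LINT x|M. c n x)"
        using c_nonneg by simp
      also have "\<dots> \<le> norm ((deriv ^^ n) f 0 / fact n * of_real r ^ n)"
      proof (cases "even n")
        case True
        have "(LINT x|M. c n x) = (r ^ n / fact n) * (LINT x|M. w x * Y x ^ n)"
          using True by (simp add: c_eq)
        also have "\<dots> \<le> norm (complex_of_real ((r ^ n / fact n) * (LINT x|M. w x * Y x ^ n)))"
          by (simp only: norm_of_real abs_ge_self)
        also have "\<dots> = norm ((deriv ^^ n) f 0 / fact n * of_real r ^ n)"
          using moment(2)[OF True] by (simp add: mult_ac)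
        finally show ?thesis .
      qed (simp add: c_odd)
      finally show "norm (LINT x|M. norm (c n x)) \<le> norm ((deriv ^^ n) f 0 / fact n * of_real r ^ n)" .
    qed
  qed
  also have "(\<lambda>x. \<Sum>n. c n x) = (\<lambda>x. w x * cosh (r * Y x))"
    using c_sums by (simp add: sums_iff)
  \<comment> \<open>The factor 2 is for \<open>exp u \<le> 2 * cosh u\<close>.\<close>
  finally have "integrable M (\<lambda>x. 2 * (w x * cosh (r * Y x)))" by simp
  then show ?thesis
    by (rule Bochner_Integration.integrable_bound)
       (auto simp: abs_mult w(2) cosh_def cosh_real_nonneg algebra_simps)
qed

lemma sum_power_div_fact_le_exp:
  fixes u :: real
  assumes "u \<ge> 0"
  shows "(\<Sum>n<N. u ^ n / fact n) \<le> exp u"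
proof -
  have "(\<lambda>n. u ^ n / fact n) sums exp u"
    using exp_converges[of u] by (simp add: divide_inverse mult.commute)
  then show ?thesis
    using assms sum_le_suminf[of "\<lambda>n. u ^ n / fact n" "{..<N}"] by (auto simp: sums_iff)
qed

text \<open>Expand the exponential under the integral: the partial sums are bounded by
  \<open>norm (w x) * exp (norm z * \<bar>Y x\<bar>)\<close>, hence by an integrable function, and
  dominated convergence yields a power series in \<open>z\<close>. The weight is complex so that it
  can carry a complex exponential tilt.\<close>

lemma exp_transform_analytic:
  fixes w :: "'a \<Rightarrow> complex" and Y :: "'a \<Rightarrow> real"
  assumes w [measurable]: "w \<in> borel_measurable M" and Y [measurable]: "Y \<in> borel_measurable M"
    and exp1: "integrable M (\<lambda>x. norm (w x) * exp (r * Y x))"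
    and exp2: "integrable M (\<lambda>x. norm (w x) * exp (- r * Y x))"
  shows "(\<lambda>z. LINT x|M. w x * exp (z * of_real (Y x))) analytic_on ball 0 r"
proof (rule power_series_analytic)
  fix z :: complex assume "z \<in> ball 0 r"
  then have z: "norm z < r" by simp
  then have r: "r > 0" using norm_ge_zero[of z] by linarith
  \<comment> \<open>One of the two summands is
    \<open>norm (w x) * exp (r * \<bar>Y x\<bar>)\<close>, whatever the sign of
    \<open>Y x\<close>.\<close>
  define W where "W x = norm (w x) * exp (r * Y x) + norm (w x) * exp (- r * Y x)" for x
  have dom: "integrable M W"
    unfolding W_def using exp1 exp2 by (rule Bochner_Integration.integrable_add)
  have le_dom: "norm (w x) * exp (u * \<bar>Y x\<bar>) \<le> W x" if "u \<le> r" for u x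
  proof -
    have "exp (u * \<bar>Y x\<bar>) \<le> exp (r * \<bar>Y x\<bar>)" using that by (simp add: mult_right_mono)
    also have "\<dots> \<le> exp (r * Y x) + exp (- r * Y x)"
      by (cases "Y x \<ge> 0") (simp_all add: less_imp_le)
    finally show ?thesis by (simp add: W_def flip: distrib_left) (simp add: mult_left_mono)
  qed
  define c where "c n x = w x * of_real (Y x ^ n / fact n)" for n x
  have norm_c: "norm (c n x) = norm (w x) * (\<bar>Y x\<bar> ^ n / fact n)" for n x
    unfolding c_def norm_mult norm_of_real by (simp add: power_abs)
  have int: "integrable M (c n)" for n
  proof -
    \<comment> \<open>A single term \<open>(r * \<bar>Y x\<bar>) ^ n / fact n\<close> of the
      exponential series is at most its sum, so \<open>norm (c n x)\<close> is at most
      \<open>W x / r ^ n\<close>.\<close>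
    have "integrable M (\<lambda>x. W x / r ^ n)"
      using dom by simp
    then show ?thesis
    proof (rule Bochner_Integration.integrable_bound)
      show "AE x in M. norm (c n x) \<le> norm (W x / r ^ n)"
      proof (rule AE_I2)
        fix x
        have "(r * \<bar>Y x\<bar>) ^ n / fact n \<le> (\<Sum>k<Suc n. (r * \<bar>Y x\<bar>) ^ k / fact k)"
          using r by (simp add: sum_nonneg)
        also have "\<dots> \<le> exp (r * \<bar>Y x\<bar>)"
          using r by (intro sum_power_div_fact_le_exp) auto
        finally have "norm (w x) * ((r * \<bar>Y x\<bar>) ^ n / fact n) \<le> norm (w x) * exp (r * \<bar>Y x\<bar>)"
          by (intro mult_left_mono) auto
        also have "\<dots> \<le> W x" by (rule le_dom) simp
        finally have "norm (c n x) \<le> W x / r ^ n"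
          unfolding norm_c using r by (simp add: field_simps power_mult_distrib)
        then show "norm (c n x) \<le> norm (W x / r ^ n)"
          by (metis abs_ge_self order_trans real_norm_def)
      qed
    qed (simp add: c_def[abs_def])
  qed
  define s where "s N x = (\<Sum>n<N. c n x * z ^ n)" for N x
  have s_bound: "norm (s N x) \<le> W x" for N x
  proof -
    have "norm (s N x) \<le> (\<Sum>n<N. norm (w x) * ((norm z * \<bar>Y x\<bar>) ^ n / fact n))"
      unfolding s_def by (intro sum_norm_le)
        (simp add: norm_mult norm_c norm_power power_mult_distrib mult_ac)
    also have "\<dots> = norm (w x) * (\<Sum>n<N. (norm z * \<bar>Y x\<bar>) ^ n / fact n)" by (simp add: sum_distrib_left)
    also have "\<dots> \<le> norm (w x) * exp (norm z * \<bar>Y x\<bar>)"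
      by (intro mult_left_mono sum_power_div_fact_le_exp) auto
    also have "\<dots> \<le> W x"
      using z by (intro le_dom) simp
    finally show ?thesis .
  qed
  have s_lim: "(\<lambda>N. s N x) \<longlonglongrightarrow> w x * exp (z * of_real (Y x))" for x
  proof -
    have "(\<lambda>n. w x * ((z * of_real (Y x)) ^ n /\<^sub>R fact n)) sums (w x * exp (z * of_real (Y x)))"
      by (intro sums_mult exp_converges)
    also have "(\<lambda>n. w x * ((z * of_real (Y x)) ^ n /\<^sub>R fact n)) = (\<lambda>n. c n x * z ^ n)"
      by (simp add: c_def fun_eq_iff scaleR_conv_of_real power_mult_distrib field_simps)
    finally show ?thesis unfolding s_def sums_def .
  qed
  have "(\<lambda>N. integral\<^sup>L M (s N)) \<longlonglongrightarrow> (LINT x|M. w x * exp (z * of_real (Y x)))"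
    by (rule integral_dominated_convergence[OF _ _ dom])
       (use s_lim s_bound in \<open>auto simp: s_def[abs_def] c_def\<close>)
  moreover have "integral\<^sup>L M (s N) = (\<Sum>n<N. integral\<^sup>L M (c n) * z ^ n)" for N
    unfolding s_def
    by (subst Bochner_Integration.integral_sum)
       (simp_all only: integrable_mult_left int integral_mult_left_zero)
  ultimately show "(\<lambda>n. integral\<^sup>L M (c n) * (z - 0) ^ n) sums (LINT x|M. w x * exp (z * of_real (Y x)))"
    unfolding sums_def by simp
qed

section \<open>Domain and analyticity of the Laplace transform\<close>

text \<open>Real exponents suffice: for measurable \<open>Y\<close>, integrability of
  \<open>exp (z * Y)\<close> depends on \<open>Re z\<close> alone, so this set is the base of the
  strip of convergence.\<close>

definition laplace_domain :: "'a measure \<Rightarrow> ('a \<Rightarrow> real) \<Rightarrow> real set" where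
  "laplace_domain M Y = {s. integrable M (\<lambda>x. exp (s * Y x))}"

definition laplace_transform :: "'a measure \<Rightarrow> ('a \<Rightarrow> real) \<Rightarrow> complex \<Rightarrow> complex" where
  "laplace_transform M Y z = (LINT x|M. exp (z * of_real (Y x)))"

lemma integrable_exp_complex_iff:
  assumes [measurable]: "Y \<in> borel_measurable M"
  shows "integrable M (\<lambda>x. exp (z * complex_of_real (Y x))) \<longleftrightarrow> Re z \<in> laplace_domain M Y"
proof -
  have "(\<lambda>x. exp (z * complex_of_real (Y x))) \<in> borel_measurable M" by measurable
  from integrable_norm_iff[OF this] show ?thesis
    by (simp add: laplace_domain_def)
qed

lemma nn_integral_exp_less_top_iff:
  assumes [measurable]: "Y \<in> borel_measurable M"
  shows "(\<integral>\<^sup>+x. ennreal (exp (s * Y x)) \<partial>M) < \<infinity> \<longleftrightarrow> s \<in> laplace_domain M Y"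
  by (simp add: laplace_domain_def integrable_iff_bounded)

text \<open>For an intermediate exponent the integrand is at most \<open>exp (a * Y)\<close> or
  \<open>exp (b * Y)\<close>, according to the sign of \<open>Y\<close>, so their sum
  dominates.\<close>

lemma is_interval_laplace_domain:
  assumes [measurable]: "Y \<in> borel_measurable M"
  shows "is_interval (laplace_domain M Y)"
  unfolding is_interval_1
proof (intro ballI allI impI, elim conjE)
  fix a b x assume ab: "a \<in> laplace_domain M Y" "b \<in> laplace_domain M Y" and x: "a \<le> x" "x \<le> b"
  have "integrable M (\<lambda>y. exp (a * Y y) + exp (b * Y y))"
    using ab unfolding laplace_domain_def by simp
  then have "integrable M (\<lambda>y. exp (x * Y y))"
  proof (rule Bochner_Integration.integrable_bound)
    have "exp (x * Y y) \<le> exp (a * Y y) + exp (b * Y y)" for y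
    proof (cases "Y y \<ge> 0")
      case True
      then have "exp (x * Y y) \<le> exp (b * Y y)" using x by (simp add: mult_right_mono)
      then show ?thesis by (smt (verit) exp_gt_zero)
    next
      case False
      then have "exp (x * Y y) \<le> exp (a * Y y)" using x by (simp add: mult_right_mono_neg)
      then show ?thesis by (smt (verit) exp_gt_zero)
    qed
    then show "AE y in M. norm (exp (x * Y y)) \<le> norm (exp (a * Y y) + exp (b * Y y))"
      by (auto simp: abs_of_nonneg add_nonneg_nonneg)
  qed measurable
  then show "x \<in> laplace_domain M Y" by (simp add: laplace_domain_def)
qed

text \<open>Absorbing \<open>exp (z * Y)\<close> into the weight moves the expansion point to 0,
  where the power series applies.\<close>

lemma laplace_transform_analytic:
  assumes Y [measurable]: "Y \<in> borel_measurable M" and z: "Re z \<in> interior (laplace_domain M Y)"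
  shows "laplace_transform M Y analytic_on {z}"
proof -
  obtain e where e: "e > 0" "cball (Re z) e \<subseteq> laplace_domain M Y"
    using z unfolding mem_interior_cball by blast
  have int: "integrable M (\<lambda>x. norm (exp (z * complex_of_real (Y x))) * exp (r * Y x))" if "\<bar>r\<bar> \<le> e" for r
  proof -
    have "Re z + r \<in> laplace_domain M Y" using e that by (auto simp: dist_norm)
    then show ?thesis by (simp add: laplace_domain_def ring_distribs exp_add)
  qed
  have "(\<lambda>u. LINT x|M. exp (z * complex_of_real (Y x)) * exp (u * of_real (Y x))) analytic_on ball 0 e"
    by (rule exp_transform_analytic) (use int[of e] int[of "-e"] e in auto)
  then have "(\<lambda>u. LINT x|M. exp (z * complex_of_real (Y x)) * exp (u * of_real (Y x))) analytic_on (\<lambda>v. v - z) ` {z}"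
    by (rule analytic_on_subset) (use e in auto)
  from analytic_on_compose[OF _ this]
  have "((\<lambda>u. LINT x|M. exp (z * complex_of_real (Y x)) * exp (u * of_real (Y x))) \<circ> (\<lambda>v. v - z)) analytic_on {z}"
    using analytic_on_diff[OF analytic_on_ident analytic_on_const] by blast
  also have "((\<lambda>u. LINT x|M. exp (z * complex_of_real (Y x)) * exp (u * of_real (Y x))) \<circ> (\<lambda>v. v - z)) = laplace_transform M Y"
    by (simp add: fun_eq_iff laplace_transform_def flip: exp_add) (simp add: ring_distribs)
  finally show ?thesis .
qed

text \<open>A strictly positive integrable function has positive integral against a probability
  measure. This gives the non-vanishing of \<open>F\<close> at real points, where zeros and poles of
  the Gamma factors may cancel.\<close>

lemma laplace_transform_real_pos:
  assumes "prob_space M" and s: "s \<in> laplace_domain M Y"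
  shows "\<exists>x>0. laplace_transform M Y (of_real s) = complex_of_real x"
proof -
  interpret prob_space M by fact
  have int: "integrable M (\<lambda>x. exp (s * Y x))" using s by (simp add: laplace_domain_def)
  have "(LINT x|M. exp (s * Y x)) \<noteq> 0"
    using integral_nonneg_eq_0_iff_AE[OF int] AE_False by simp
  moreover have "(LINT x|M. exp (s * Y x)) \<ge> 0"
    by simp
  ultimately have "(LINT x|M. exp (s * Y x)) > 0"
    by linarith
  moreover have "laplace_transform M Y (of_real s) = of_real (LINT x|M. exp (s * Y x))"
    unfolding laplace_transform_def
    by (simp only: integral_complex_of_real[symmetric] exp_of_real[symmetric] of_real_mult)
  ultimately show ?thesis by blast
qed

section \<open>Bounds and identities at accumulation points\<close>

text \<open>Converts what is known on a ray into \<open>frequently\<close> at its end point, the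
  form in which both the exclusion of poles and the identity theorem take it.\<close>

lemma frequently_at_ray:
  fixes c u :: complex
  assumes "d > 0" "u \<noteq> 0" and P: "\<And>t. 0 < t \<Longrightarrow> t < d \<Longrightarrow> P (c + of_real t * u)"
  shows "frequently P (at c)"
proof -
  have "filterlim (\<lambda>t. c + of_real t * u) (at c) (at_right 0)"
    unfolding filterlim_at using assms(2)
    by (auto intro!: tendsto_eq_intros simp: eventually_at_filter)
  moreover have "eventually (\<lambda>t. P (c + of_real t * u)) (at_right 0)"
    using P assms(1) by (auto simp: eventually_at_right_field)
  ultimately show ?thesis
    unfolding frequently_def
  proof (intro notI)
    assume lim: "filterlim (\<lambda>t. c + of_real t * u) (at c) (at_right 0)"
      and ev: "eventually (\<lambda>t. P (c + of_real t * u)) (at_right 0)"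
      and "eventually (\<lambda>z. \<not> P z) (at c)"
    then have "eventually (\<lambda>t. \<not> P (c + of_real t * u)) (at_right 0)"
      unfolding filterlim_iff by blast
    with ev have "eventually (\<lambda>t. False) (at_right (0::real))"
      by eventually_elim simp
    then show False by simp
  qed
qed

lemma not_is_pole_if_frequently_bounded:
  assumes "frequently (\<lambda>z. norm (F z) \<le> B) (at c)"
  shows "\<not> is_pole F c"
proof
  assume "is_pole F c"
  then have "filterlim (\<lambda>z. norm (F z)) at_top (at c)"
    unfolding is_pole_def by (rule filterlim_at_infinity_imp_norm_at_top)
  then have "eventually (\<lambda>z. norm (F z) > B) (at c)"
    unfolding filterlim_at_top_dense by blast
  then have "eventually (\<lambda>z. \<not> norm (F z) \<le> B) (at c)"
    by eventually_elim simp
  with assms show False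
    by (simp add: frequently_def)
qed

text \<open>Identity theorem on the open convex strip: on punctured neighbourhoods the difference
  either vanishes near every point or is nonzero near every point, and the assumed agreement
  excludes the latter.\<close>

lemma laplace_transform_continuation:
  assumes Y: "Y \<in> borel_measurable M"
    and F: "F nicely_meromorphic_on UNIV"
    and p: "p \<in> interior (laplace_domain M Y)"
    and freq: "frequently (\<lambda>z. F z = laplace_transform M Y z) (at (of_real p))"
    and z: "Re z \<in> interior (laplace_domain M Y)"
  shows "\<not> is_pole F z" "F z = laplace_transform M Y z"
proof -
  let ?L = "laplace_transform M Y"
  define S where "S = Re -` interior (laplace_domain M Y)"
  have S: "open S" unfolding S_def by (intro open_vimage continuous_intros) auto
  have "convex (laplace_domain M Y)"
    using is_interval_laplace_domain[OF Y] by (rule is_interval_convex)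
  then have "convex S"
    unfolding S_def by (intro convex_linear_vimage convex_interior) (auto simp: bounded_linear.linear bounded_linear_Re)
  then have conn: "connected S" by (rule convex_connected)
  have L: "?L analytic_on {w}" if "w \<in> S" for w
    using laplace_transform_analytic[OF Y] that by (auto simp: S_def)
  then have L': "?L analytic_on S"
    using analytic_on_analytic_at by blast
  have "(\<lambda>w. F w - ?L w) meromorphic_on S"
    using F L' unfolding nicely_meromorphic_on_def
    by (intro meromorphic_on_diff analytic_on_imp_meromorphic_on[of ?L]) (auto intro: meromorphic_on_subset)
  from meromorphic_imp_constant_or_avoid[OF this S conn, of 0]
  have "(\<forall>w\<in>S. eventually (\<lambda>w. F w = ?L w) (at w)) \<or> (\<forall>w\<in>S. eventually (\<lambda>w. F w \<noteq> ?L w) (at w))"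
    by (simp add: eventually_cosparse_open_eq S)
  moreover have "of_real p \<in> S" using p by (simp add: S_def)
  ultimately have ev: "eventually (\<lambda>w. F w = ?L w) (at z)"
    using freq z unfolding frequently_def by (auto simp: S_def)
  have lim: "?L \<midarrow>z\<rightarrow> ?L z"
    using L[of z] z analytic_at_imp_isCont isContD by (auto simp: S_def)
  \<comment> \<open>A finite limit excludes a pole, and nice meromorphy then makes the value of
    \<open>F\<close> equal to its limit, which upgrades agreement on a punctured neighbourhood to
    agreement at \<open>z\<close>.\<close>
  have lim': "F \<midarrow>z\<rightarrow> ?L z"
    by (rule Lim_transform_eventually[OF lim]) (use ev in \<open>auto elim: eventually_mono\<close>)
  then show np: "\<not> is_pole F z"
    unfolding is_pole_def using not_tendsto_and_filterlim_at_infinity at_neq_bot by blast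
  have "F \<midarrow>z\<rightarrow> F z" using F np unfolding nicely_meromorphic_on_def by auto
  with lim' show "F z = ?L z" using LIM_unique by blast
qed

section \<open>End points of the domain\<close>

text \<open>The common situation to which the moment conditions lead. Agreement is asked at points
  accumulating at \<open>p\<close>, which covers real intervals and pieces of the imaginary axis
  alike.\<close>

locale laplace_continuation = prob_space M for M :: "'a measure" +
  fixes Y :: "'a \<Rightarrow> real" and F :: "complex \<Rightarrow> complex" and p :: real
  assumes Y [measurable]: "Y \<in> borel_measurable M"
    and F: "F nicely_meromorphic_on UNIV"
    and p: "p \<in> interior (laplace_domain M Y)"
    and freq: "frequently (\<lambda>z. F z = laplace_transform M Y z) (at (of_real p))"
begin

lemma continuation:
  assumes "Re z \<in> interior (laplace_domain M Y)"
  shows "\<not> is_pole F z" "F z = laplace_transform M Y z"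
  using laplace_transform_continuation[OF Y F p freq assms] by auto

lemma zero_in_domain: "0 \<in> laplace_domain M Y"
  by (simp add: laplace_domain_def)

lemma convex_domain: "convex (laplace_domain M Y)"
  using is_interval_laplace_domain[OF Y] by (rule is_interval_convex)

lemma shrink_in_interior:
  assumes "c \<in> closure (laplace_domain M Y)" "0 < t" "t \<le> 1"
  shows "c + t * (p - c) \<in> interior (laplace_domain M Y)"
  using mem_interior_closure_convex_shrink[OF convex_domain p assms] by (simp add: algebra_simps)

lemma norm_laplace_transform_le:
  "norm (laplace_transform M Y z) \<le> (LINT x|M. exp (Re z * Y x))"
  unfolding laplace_transform_def by (rule order_trans[OF integral_norm_bound]) simp

text \<open>
  On the segment from \<open>c\<close> to \<open>p\<close> the transform stays bounded, because the integrand is convex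
  in the exponent, so \<open>F\<close> cannot blow up at \<open>c\<close>.
\<close>
lemma not_pole_in_domain:
  assumes c: "c \<in> laplace_domain M Y"
  shows "\<not> is_pole F (of_real c)"
proof (cases "c = p")
  case True
  then show ?thesis using continuation(1)[of "of_real p"] p by simp
next
  case False
  have cint: "integrable M (\<lambda>x. exp (c * Y x))" using c by (simp add: laplace_domain_def)
  have pint: "integrable M (\<lambda>x. exp (p * Y x))"
    using p interior_subset by (auto simp: laplace_domain_def)
  define B where "B = (LINT x|M. exp (c * Y x) + exp (p * Y x))"
  have "frequently (\<lambda>z. norm (F z) \<le> B) (at (of_real c))"
  proof (rule frequently_at_ray[where d = 1 and u = "of_real (p - c)"])
    fix t :: real assume t: "0 < t" "t < 1"
    define s where "s = c + t * (p - c)"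
    have s: "s \<in> interior (laplace_domain M Y)"
      unfolding s_def using t c closure_subset by (intro shrink_in_interior) auto
    have "exp (s * Y x) \<le> exp (c * Y x) + exp (p * Y x)" for x
    proof -
      have "s * Y x = (1 - t) * (c * Y x) + t * (p * Y x)" by (simp add: s_def algebra_simps)
      also have "\<dots> \<le> max (c * Y x) (p * Y x)"
        using t by (intro convex_bound_le) auto
      finally have "exp (s * Y x) \<le> exp (max (c * Y x) (p * Y x))" by simp
      also have "\<dots> \<le> exp (c * Y x) + exp (p * Y x)" by (auto simp: max_def less_imp_le)
      finally show ?thesis .
    qed
    moreover have "integrable M (\<lambda>x. exp (s * Y x))"
      using s interior_subset by (auto simp: laplace_domain_def)
    ultimately have "(LINT x|M. exp (s * Y x)) \<le> B"
      unfolding B_def using cint pint by (intro integral_mono) auto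
    moreover have "F (of_real s) = laplace_transform M Y (of_real s)"
      using continuation(2)[of "of_real s"] s by simp
    ultimately have "norm (F (of_real s)) \<le> B"
      using norm_laplace_transform_le[of "of_real s"] by simp
    then show "norm (F (of_real c + of_real t * of_real (p - c))) \<le> B"
      by (simp add: s_def)
  qed (use False in auto)
  then show ?thesis by (rule not_is_pole_if_frequently_bounded)
qed

text \<open>
  Landau's argument: tilting the measure to an interior point near \<open>c\<close>, the Taylor disc of \<open>F\<close>
  there contains \<open>c\<close>.
\<close>
lemma in_interior_if_not_pole:
  assumes c: "c \<in> closure (laplace_domain M Y)" and np: "\<not> is_pole F (of_real c)"
  shows "c \<in> interior (laplace_domain M Y)"
proof -
  have "F analytic_on {of_real c}"
    using nicely_meromorphic_on_imp_analytic_at[OF F _ np] by simp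
  then obtain e where e: "e > 0" "F holomorphic_on ball (of_real c) e"
    unfolding analytic_on_def by auto
  \<comment> \<open>\<open>t\<close> puts \<open>q\<close> within \<open>e / 4\<close> of
    \<open>c\<close>, so the disc of radius \<open>e / 2\<close> about \<open>q\<close> lies in the
    disc of analyticity and still covers all points at distance less than \<open>e / 4\<close> from
    \<open>c\<close>. The summand 1 covers the case \<open>p = c\<close>.\<close>
  define t where "t = min 1 (e / (4 * (\<bar>p - c\<bar> + 1)))"
  have t: "0 < t" "t \<le> 1" using e by (auto simp: t_def intro!: divide_pos_pos add_nonneg_pos)
  define q where "q = c + t * (p - c)"
  have q: "q \<in> interior (laplace_domain M Y)"
    unfolding q_def using shrink_in_interior[OF c t] .
  have "\<bar>q - c\<bar> = t * \<bar>p - c\<bar>" using t by (simp add: q_def abs_mult)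
  also have "\<dots> \<le> e / (4 * (\<bar>p - c\<bar> + 1)) * (\<bar>p - c\<bar> + 1)"
    using t e by (intro mult_mono) (auto simp: t_def)
  also have "\<dots> = e / 4" by (auto simp: divide_simps algebra_simps add_nonneg_eq_0_iff)
  finally have qc: "\<bar>q - c\<bar> \<le> e / 4" .
  have qint: "integrable M (\<lambda>x. exp (q * Y x))"
    using q interior_subset by (auto simp: laplace_domain_def)
  have sub: "(\<lambda>z. of_real q + z) ` ball 0 (e / 2) \<subseteq> ball (complex_of_real c) e"
  proof safe
    fix z :: complex assume "z \<in> ball 0 (e / 2)"
    moreover have "norm (of_real (c - q) - z) \<le> \<bar>q - c\<bar> + norm z"
      by (metis abs_minus_commute norm_of_real norm_triangle_ineq4)
    ultimately show "of_real q + z \<in> ball (of_real c) e"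
      using qc e by (auto simp: dist_norm diff_diff_add)
  qed
  have "(F \<circ> (\<lambda>z. of_real q + z)) holomorphic_on ball 0 (e / 2)"
    by (rule holomorphic_on_compose)
       (use holomorphic_on_subset[OF e(2) sub] in \<open>auto intro!: holomorphic_intros\<close>)
  then have an: "(\<lambda>z. F (of_real q + z)) analytic_on ball 0 (e / 2)"
    by (simp add: analytic_on_open o_def)
  have eq: "(LINT x|M. of_real (exp (q * Y x)) * exp (\<i> * of_real t * of_real (Y x))) = F (of_real q + \<i> * of_real t)" for t
    using continuation(2)[of "of_real q + \<i> * of_real t"] q
    by (simp add: laplace_transform_def ring_distribs exp_add flip: exp_of_real)
  have "s \<in> laplace_domain M Y" if "s \<in> ball c (e / 4)" for s
  proof -
    have "\<bar>s - q\<bar> < e / 2" using that qc unfolding mem_ball dist_real_def by linarith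
    from exp_integrable_of_analytic_transform[OF qint _ Y an eq zero_less_one this]
    show ?thesis by (simp add: laplace_domain_def flip: exp_add) (simp add: algebra_simps)
  qed
  then show ?thesis using e unfolding mem_interior by (intro exI[of _ "e / 4"]) auto
qed

text \<open>No point of the domain is a pole of \<open>F\<close>, and a point of the closure that is
  not a pole is interior.\<close>

lemma open_domain: "open (laplace_domain M Y)"
proof -
  have "laplace_domain M Y \<subseteq> interior (laplace_domain M Y)"
    using in_interior_if_not_pole not_pole_in_domain closure_subset by blast
  then show ?thesis
    by (metis interior_subset open_interior subset_antisym)
qed

text \<open>Going from 0 towards \<open>s\<close>, the first point outside the open domain lies in
  its closure but not in its interior, and is therefore a pole.\<close>

lemma pole_between_zero_and_outside:
  assumes "s \<notin> laplace_domain M Y"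
  shows "\<exists>c\<in>closed_segment 0 s. c \<noteq> 0 \<and> is_pole F (of_real c)"
proof -
  let ?D = "laplace_domain M Y"
  have "compact (closed_segment 0 s - ?D)"
    using open_domain by (intro compact_diff) auto
  moreover have "closed_segment 0 s - ?D \<noteq> {}" using assms by auto
  ultimately have "\<exists>c\<in>closed_segment 0 s - ?D. \<forall>x\<in>closed_segment 0 s - ?D. norm c \<le> norm x"
    by (rule continuous_attains_inf[OF _ _ continuous_on_norm_id])
  then obtain c where c: "c \<in> closed_segment 0 s - ?D" "\<And>x. x \<in> closed_segment 0 s - ?D \<Longrightarrow> norm c \<le> norm x"
    by (elim bexE) (rule that, auto)
  have c0: "c \<noteq> 0" using c zero_in_domain by auto
  have "open_segment 0 c \<subseteq> ?D"
  proof
    fix x assume x: "x \<in> open_segment 0 c"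
    then have "x \<in> closed_segment 0 s"
      using c by (meson DiffD1 ends_in_segment(1) in_mono open_closed_segment subset_closed_segment)
    moreover have "norm x < norm c"
      using x c0 by (auto simp: in_segment abs_mult)
    ultimately show "x \<in> ?D" using c(2)[of x] by force
  qed
  then have "closed_segment 0 c \<subseteq> closure ?D"
    using c0 closure_mono[of "open_segment 0 c" ?D] by (simp add: closure_open_segment)
  then have "c \<in> closure ?D" by auto
  moreover have "c \<notin> interior ?D" using c interior_subset by blast
  ultimately have "is_pole F (of_real c)" using in_interior_if_not_pole by blast
  with c c0 show ?thesis by auto
qed

end

section \<open>Real poles and the extremal abscissas\<close>

text \<open>Poles do not accumulate, so a compact interval has finitely many; hence the extrema in
  \<open>rho_plus\<close> and \<open>rho_minus\<close> are attained.\<close>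

lemma finite_real_poles:
  assumes "F nicely_meromorphic_on UNIV"
  shows "finite {x \<in> {a..b}. is_pole F (complex_of_real x)}"
proof -
  have "{z. is_pole F z} sparse_in UNIV"
    using meromorphic_on_imp_not_pole_cosparse[of F UNIV] assms
    by (simp add: nicely_meromorphic_on_def eventually_cosparse)
  then have "{z. is_pole F z} sparse_in of_real ` {a..b}"
    by (rule sparse_in_subset) auto
  then have "finite (of_real ` {a..b} \<inter> {z. is_pole F z})"
    by (rule sparse_in_compact_finite) (intro compact_continuous_image continuous_intros, auto)
  then have "finite (of_real -` (of_real ` {a..b} \<inter> {z. is_pole F z}) :: real set)"
    by (rule finite_vimageI) (auto simp: inj_on_def)
  then show ?thesis by (rule finite_subset[rotated]) auto
qed

text \<open>The finitely many positive poles up to a known one have a minimum, which makes the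
  \<open>LEAST\<close> meaningful, as the reals are not well-ordered.\<close>

lemma rho_plus_le_iff:
  assumes "F nicely_meromorphic_on UNIV"
  shows "rho_plus F \<le> ereal s \<longleftrightarrow> (\<exists>x>0. x \<le> s \<and> is_pole F (of_real x))"
proof (cases "\<exists>x>0. is_pole F (of_real x)")
  case True
  then obtain x0 where x0: "x0 > 0" "is_pole F (of_real x0)" by auto
  \<comment> \<open>0 is taken out: a pole there does not count for \<open>rho_plus\<close>.\<close>
  define A where "A = {x \<in> {0..x0}. is_pole F (of_real x)} - {0}"
  have "finite A"
    using finite_real_poles[OF assms, of 0 x0] by (simp add: A_def)
  moreover have "x0 \<in> A" using x0 by (simp add: A_def)
  ultimately have "finite A" "A \<noteq> {}" by auto
  note Min = Min_in[OF this] Min_le[OF this(1)]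
  have le: "Min A \<le> y" if "y > 0" "is_pole F (of_real y)" for y
    using that Min(2)[of y] Min(1) by (cases "y \<le> x0") (auto simp: A_def)
  have pole: "Min A > 0" "is_pole F (of_real (Min A))" using Min(1) by (auto simp: A_def)
  have "(LEAST x. x > 0 \<and> is_pole F (of_real x)) = Min A"
    by (rule Least_equality) (use le pole in auto)
  then show ?thesis
    using True le pole by (auto simp: rho_plus_def intro: order_trans)
qed (auto simp: rho_plus_def)

lemma rho_minus_ge_iff:
  assumes "F nicely_meromorphic_on UNIV"
  shows "ereal s \<le> rho_minus F \<longleftrightarrow> (\<exists>x<0. s \<le> x \<and> is_pole F (of_real x))"
proof (cases "\<exists>x<0. is_pole F (of_real x)")
  case True
  then obtain x0 where x0: "x0 < 0" "is_pole F (of_real x0)" by auto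
  define A where "A = {x \<in> {x0..0}. is_pole F (of_real x)} - {0}"
  have "finite A"
    using finite_real_poles[OF assms, of x0 0] by (simp add: A_def)
  moreover have "x0 \<in> A" using x0 by (simp add: A_def)
  ultimately have "finite A" "A \<noteq> {}" by auto
  note Max = Max_in[OF this] Max_ge[OF this(1)]
  have ge: "y \<le> Max A" if "y < 0" "is_pole F (of_real y)" for y
    using that Max(2)[of y] Max(1) by (cases "x0 \<le> y") (auto simp: A_def)
  have pole: "Max A < 0" "is_pole F (of_real (Max A))" using Max(1) by (auto simp: A_def)
  have "(GREATEST x. x < 0 \<and> is_pole F (of_real x)) = Max A"
    by (rule Greatest_equality) (use ge pole in auto)
  then show ?thesis
    using True ge pole by (auto simp: rho_minus_def intro: order_trans)
qed (auto simp: rho_minus_def)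

text \<open>\<open>s\<close> lies outside exactly when the segment from 0 to \<open>s\<close>
  contains a nonzero pole; the sign of \<open>s\<close> decides which abscissa is concerned.\<close>

lemma (in laplace_continuation) domain_eq:
  "s \<in> laplace_domain M Y \<longleftrightarrow> rho_minus F < ereal s \<and> ereal s < rho_plus F"
proof -
  have "s \<notin> laplace_domain M Y \<longleftrightarrow> (\<exists>c. c \<in> closed_segment 0 s \<and> c \<noteq> 0 \<and> is_pole F (of_real c))"
  proof
    assume "\<exists>c. c \<in> closed_segment 0 s \<and> c \<noteq> 0 \<and> is_pole F (of_real c)"
    then obtain c where c: "c \<in> closed_segment 0 s" "is_pole F (of_real c)" by blast
    show "s \<notin> laplace_domain M Y"
    proof
      assume "s \<in> laplace_domain M Y"
      then have "closed_segment 0 s \<subseteq> laplace_domain M Y"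
        by (intro closed_segment_subset zero_in_domain convex_domain)
      then show False using c not_pole_in_domain by blast
    qed
  qed (use pole_between_zero_and_outside in blast)
  also have "\<dots> \<longleftrightarrow> (\<exists>c. (c > 0 \<and> c \<le> s \<and> is_pole F (of_real c)) \<or> (c < 0 \<and> s \<le> c \<and> is_pole F (of_real c)))"
    by (intro arg_cong[where f = Ex] ext) (auto simp: closed_segment_eq_real_ivl)
  also have "\<dots> \<longleftrightarrow> rho_plus F \<le> ereal s \<or> ereal s \<le> rho_minus F"
    unfolding rho_plus_le_iff[OF F] rho_minus_ge_iff[OF F] ex_disj_distrib ..
  finally show ?thesis by (auto simp: not_le)
qed

section \<open>Functions of Gamma type\<close>

text \<open>Gamma is the reciprocal of the entire function \<open>rGamma\<close>, so the quotient is
  meromorphic, and \<open>remove_sings\<close> normalises its values.\<close>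

lemma gamma_type_fun_nicely_meromorphic:
  "gamma_type_fun C D J a b K a' b' nicely_meromorphic_on UNIV"
proof -
  have Gamma: "(\<lambda>s. Gamma (of_real \<alpha> * s + of_real \<beta>) :: complex) meromorphic_on UNIV" for \<alpha> \<beta>
  proof -
    have "(\<lambda>s. rGamma (of_real \<alpha> * s + of_real \<beta>) :: complex) analytic_on UNIV"
      by (intro analytic_intros)
    then have "(\<lambda>s. inverse (rGamma (of_real \<alpha> * s + of_real \<beta>)) :: complex) meromorphic_on UNIV"
      by (intro meromorphic_intros analytic_on_imp_meromorphic_on)
    then show ?thesis by (simp add: rGamma_inverse_Gamma)
  qed
  have "(\<lambda>s. of_real D powr s :: complex) meromorphic_on UNIV"
  proof (cases "D = 0")
    case False
    then show ?thesis
      by (auto simp: powr_def intro!: analytic_on_imp_meromorphic_on analytic_intros)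
  qed (simp add: meromorphic_on_const)
  then show ?thesis
    unfolding gamma_type_fun_def
    by (intro remove_sings_nicely_meromorphic meromorphic_intros Gamma)
qed

text \<open>For nonreal \<open>s\<close> every Gamma argument is nonreal, since the slopes are
  nonzero; Gamma is analytic and nonzero there, and \<open>remove_sings\<close> changes
  nothing.\<close>

lemma gamma_type_fun_nonreal_nonzero:
  assumes "C \<noteq> 0" "D > 0" "\<forall>j\<in>{1..J}. a j \<noteq> 0" "\<forall>k\<in>{1..K}. a' k \<noteq> 0" "Im s \<noteq> 0"
  shows "gamma_type_fun C D J a b K a' b' s \<noteq> 0"
proof -
  have arg: "of_real \<alpha> * s + of_real \<beta> \<notin> \<int>\<^sub>\<le>\<^sub>0" if "\<alpha> \<noteq> 0" for \<alpha> \<beta> :: real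
  proof
    assume "of_real \<alpha> * s + of_real \<beta> \<in> \<int>\<^sub>\<le>\<^sub>0"
    then obtain n where "of_real \<alpha> * s + of_real \<beta> = of_int n" by (auto elim!: nonpos_Ints_cases)
    then have "Im (of_real \<alpha> * s + of_real \<beta>) = Im (of_int n)" by (rule arg_cong)
    then show False using assms(5) that by simp
  qed
  have "(\<lambda>s. of_real C * of_real D powr s *
       (\<Prod>j=1..J. Gamma (of_real (a j) * s + of_real (b j))) /
       (\<Prod>k=1..K. Gamma (of_real (a' k) * s + of_real (b' k)))) analytic_on {s}"
    unfolding powr_def using assms arg
    by (auto intro!: analytic_intros simp: Gamma_eq_zero_iff)
  then have "gamma_type_fun C D J a b K a' b' s = of_real C * of_real D powr s *
       (\<Prod>j=1..J. Gamma (of_real (a j) * s + of_real (b j))) /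
       (\<Prod>k=1..K. Gamma (of_real (a' k) * s + of_real (b' k)))"
    unfolding gamma_type_fun_def by (rule remove_sings_at_analytic)
  then show ?thesis
    using assms arg by (auto simp: Gamma_eq_zero_iff)
qed

text \<open>Serves to exclude \<open>C = 0\<close>, because \<open>F 0\<close> must be the zeroth
  moment 1.\<close>

lemma gamma_type_fun_zero: "gamma_type_fun 0 D J a b K a' b' s = 0"
  unfolding gamma_type_fun_def by (rule remove_sings_eqI) simp

section \<open>From moment equations to the continuation situation\<close>

lemma exp_moment_eq_iff:
  assumes "Y \<in> borel_measurable M"
  shows "exp_moment_eq M Y F s \<longleftrightarrow>
    Re s \<in> laplace_domain M Y \<and> \<not> is_pole F s \<and> laplace_transform M Y s = F s"
  using integrable_exp_complex_iff[OF assms]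
  by (simp add: exp_moment_eq_def expectation_eq_at_def laplace_transform_def)

lemma power_moment_eq_iff_exp_moment_eq:
  assumes [measurable]: "X \<in> borel_measurable M" "Y \<in> borel_measurable M"
    and XY: "AE \<omega> in M. X \<omega> = exp (Y \<omega>)"
  shows "power_moment_eq M X F s \<longleftrightarrow> exp_moment_eq M Y F s"
proof -
  \<comment> \<open>\<open>X\<close> is positive almost everywhere, so measurability of the power
    has to cover all real arguments: at negative ones the principal logarithm adds
    \<open>\<i> * pi\<close>, and at 0 the power is 0 by convention.\<close>
  have "(\<lambda>x::real. complex_of_real x powr s) =
      (\<lambda>x. if x = 0 then 0 else if x > 0 then exp (s * of_real (ln x)) else exp (s * (of_real (ln (-x)) + \<i> * of_real pi)))"
  proof
    fix x :: real
    have "Ln (complex_of_real x) = of_real (ln (-x)) + \<i> * of_real pi" if "x < 0"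
      using that Ln_minus[of "complex_of_real (-x)"] Ln_of_real[of "-x"] by simp
    then show "complex_of_real x powr s = (if x = 0 then 0 else if x > 0 then exp (s * of_real (ln x)) else exp (s * (of_real (ln (-x)) + \<i> * of_real pi)))"
      by (auto simp: powr_def Ln_of_real not_less)
  qed
  also have "\<dots> \<in> borel_measurable borel" by measurable
  finally have [measurable]: "(\<lambda>x::real. complex_of_real x powr s) \<in> borel_measurable borel" .
  have ae: "AE \<omega> in M. complex_of_real (X \<omega>) powr s = exp (s * complex_of_real (Y \<omega>))"
    using XY by eventually_elim (simp add: powr_def Ln_of_real)
  have "integrable M (\<lambda>\<omega>. complex_of_real (X \<omega>) powr s) \<longleftrightarrow> integrable M (\<lambda>\<omega>. exp (s * complex_of_real (Y \<omega>)))"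
    using ae by (intro integrable_cong_AE) measurable
  moreover have "(LINT \<omega>|M. complex_of_real (X \<omega>) powr s) = (LINT \<omega>|M. exp (s * complex_of_real (Y \<omega>)))"
    using ae by (intro integral_cong_AE) measurable
  ultimately show ?thesis
    by (simp add: power_moment_eq_def exp_moment_eq_def expectation_eq_at_def)
qed

text \<open>The midpoint of the interval serves as \<open>p\<close>; agreement to its right supplies
  the accumulating points.\<close>

lemma laplace_continuation_if_interval:
  assumes "prob_space M" and Y: "Y \<in> borel_measurable M" and F: "F nicely_meromorphic_on UNIV"
    and "u < v" and eq: "\<And>s. s \<in> {u..v} \<Longrightarrow> exp_moment_eq M Y F (of_real s)"
  shows "\<exists>p. laplace_continuation M Y F p"
proof -
  have "{u<..<v} \<subseteq> laplace_domain M Y"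
    using eq by (auto simp: exp_moment_eq_iff[OF Y])
  then have "{u<..<v} \<subseteq> interior (laplace_domain M Y)"
    by (intro interior_maximal) auto
  then have "(u + v) / 2 \<in> interior (laplace_domain M Y)"
    using \<open>u < v\<close> by auto
  moreover have "frequently (\<lambda>z. F z = laplace_transform M Y z) (at (of_real ((u + v) / 2)))"
  proof (rule frequently_at_ray[where d = "(v - u) / 2" and u = 1])
    fix t :: real assume "0 < t" "t < (v - u) / 2"
    then have "(u + v) / 2 + t \<in> {u..v}" using \<open>u < v\<close> by (auto simp: field_simps)
    from eq[OF this] show "F (of_real ((u + v) / 2) + of_real t * 1) = laplace_transform M Y (of_real ((u + v) / 2) + of_real t * 1)"
      by (simp add: exp_moment_eq_iff[OF Y])
  qed (use \<open>u < v\<close> in auto)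
  ultimately show ?thesis
    using assms unfolding laplace_continuation_def laplace_continuation_axioms_def by blast
qed

text \<open>A characteristic function is bounded by 1, so \<open>F\<close> stays bounded along the
  imaginary axis near 0 and has no pole there. On a Taylor disc of \<open>F\<close> about 0, the
  exponential integrability criterion with weight 1 then puts a neighbourhood of 0 into the
  domain.\<close>

lemma laplace_continuation_if_imaginary:
  assumes "prob_space M" and Y [measurable]: "Y \<in> borel_measurable M" and F: "F nicely_meromorphic_on UNIV"
    and t0: "t0 > 0" and eq: "\<And>t. t \<noteq> 0 \<Longrightarrow> \<bar>t\<bar> < t0 \<Longrightarrow> exp_moment_eq M Y F (\<i> * of_real t)"
  shows "\<exists>p. laplace_continuation M Y F p"
proof -
  interpret prob_space M by fact
  have eq': "F (\<i> * of_real t) = laplace_transform M Y (\<i> * of_real t)" if "t \<noteq> 0" "\<bar>t\<bar> < t0" for t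
    using eq[OF that] by (simp add: exp_moment_eq_iff[OF Y])
  have "frequently (\<lambda>z. norm (F z) \<le> 1) (at 0)"
  proof (rule frequently_at_ray[where d = t0 and u = \<i>])
    fix t assume "0 < t" "t < t0"
    then have "F (0 + of_real t * \<i>) = laplace_transform M Y (\<i> * of_real t)"
      using eq'[of t] by (simp add: mult.commute)
    also have "norm \<dots> \<le> (LINT x|M. norm (exp (\<i> * of_real t * complex_of_real (Y x))))"
      unfolding laplace_transform_def by (rule integral_norm_bound)
    also have "\<dots> = 1" using prob_space by simp
    finally show "norm (F (0 + of_real t * \<i>)) \<le> 1" .
  qed (use t0 in auto)
  then have "\<not> is_pole F 0" by (rule not_is_pole_if_frequently_bounded)
  then have an: "F analytic_on {0}"
    using F by (intro nicely_meromorphic_on_imp_analytic_at) auto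
  then obtain R where R: "R > 0" "F holomorphic_on ball 0 R"
    unfolding analytic_on_def by auto
  \<comment> \<open>The hypothesis says nothing at \<open>t = 0\<close>; both sides are continuous
    there, so the value follows as a limit.\<close>
  have F0: "F 0 = 1"
  proof -
    \<comment> \<open>The shift by 2 keeps \<open>h 0 = t0 / 2\<close> strictly below
      \<open>t0\<close>.\<close>
    define h where "h n = t0 / real (n + 2)" for n
    have h: "h n \<noteq> 0" "\<bar>h n\<bar> < t0" for n
      using t0 by (auto simp: h_def field_simps intro!: add_pos_nonneg)
    have h0: "h \<longlonglongrightarrow> 0" unfolding h_def by real_asymp
    have "(\<lambda>n. laplace_transform M Y (\<i> * of_real (h n))) \<longlonglongrightarrow> (LINT x|M. 1)"
      unfolding laplace_transform_def
    proof (rule integral_dominated_convergence[where w = "\<lambda>_. 1"])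
      have "(\<lambda>n. exp (\<i> * of_real (h n) * complex_of_real (Y x))) \<longlonglongrightarrow> exp (\<i> * of_real 0 * complex_of_real (Y x))" for x
        by (intro tendsto_intros h0)
      then show "AE x in M. (\<lambda>n. exp (\<i> * of_real (h n) * complex_of_real (Y x))) \<longlonglongrightarrow> 1"
        by simp
    qed auto
    then have "(\<lambda>n. F (\<i> * of_real (h n))) \<longlonglongrightarrow> 1"
      using eq'[OF h] prob_space by simp
    moreover have "(\<lambda>n. \<i> * complex_of_real (h n)) \<longlonglongrightarrow> \<i> * of_real 0"
      by (intro tendsto_intros h0)
    then have "(\<lambda>n. F (\<i> * of_real (h n))) \<longlonglongrightarrow> F 0"
      using analytic_at_imp_isCont[OF an] by (intro isCont_tendsto_compose[of 0 F]) auto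
    ultimately show ?thesis using LIMSEQ_unique by blast
  qed
  have "(LINT x|M. of_real 1 * exp (\<i> * of_real t * of_real (Y x))) = F (\<i> * of_real t)" if "\<bar>t\<bar> < t0" for t
    using that eq'[of t] F0 prob_space by (cases "t = 0") (simp_all add: laplace_transform_def)
  note exp_integrable_of_analytic_transform[of M "\<lambda>_. 1", OF _ _ Y _ this t0]
  then have "ball 0 R \<subseteq> laplace_domain M Y"
    using R by (auto simp: laplace_domain_def analytic_on_open)
  then have "0 \<in> interior (laplace_domain M Y)"
    using R unfolding mem_interior by blast
  moreover have "frequently (\<lambda>z. F z = laplace_transform M Y z) (at (of_real 0))"
  proof (rule frequently_at_ray[where d = t0 and u = \<i>])
    fix t assume "0 < t" "t < t0"
    then show "F (of_real 0 + of_real t * \<i>) = laplace_transform M Y (of_real 0 + of_real t * \<i>)"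
      using eq'[of t] by (simp add: mult.commute)
  qed (use t0 in auto)
  ultimately show ?thesis
    using assms unfolding laplace_continuation_def laplace_continuation_axioms_def by blast
qed

lemma (in laplace_continuation) exp_moment_eq_in_strip:
  assumes "Re s \<in> laplace_domain M Y"
  shows "exp_moment_eq M Y F s"
  using assms continuation[of s] open_domain by (simp add: exp_moment_eq_iff[OF Y] interior_open)

section \<open>Extremal exponents and the equivalence of the six conditions\<close>

lemma ereal_Sup_real_segment:
  assumes "m < 0" "0 < (p :: ereal)"
  shows "Sup (ereal ` {s. s \<ge> 0 \<and> m < ereal s \<and> ereal s < p}) = p"
proof (rule Sup_eqI)
  fix y assume y: "\<And>z. z \<in> ereal ` {s. s \<ge> 0 \<and> m < ereal s \<and> ereal s < p} \<Longrightarrow> z \<le> y"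
  show "p \<le> y"
  proof (rule ccontr)
    assume "\<not> p \<le> y"
    \<comment> \<open>The maximum with 0 forces a nonnegative witness, which then lies above
      \<open>m\<close>.\<close>
    then have "max y 0 < p" using assms by auto
    then obtain r where r: "max y 0 < ereal r" "ereal r < p" using ereal_dense2 by blast
    then have "r \<ge> 0" by simp
    then have "0 \<le> ereal r" by simp
    with assms(1) have "m < ereal r" by (rule less_le_trans)
    then show False using y[of "ereal r"] r by auto
  qed
qed auto

lemma ereal_Inf_real_segment:
  assumes "m < 0" "0 < (p :: ereal)"
  shows "Inf (ereal ` {s. s \<le> 0 \<and> m < ereal s \<and> ereal s < p}) = m"
proof (rule Inf_eqI)
  fix y assume y: "\<And>z. z \<in> ereal ` {s. s \<le> 0 \<and> m < ereal s \<and> ereal s < p} \<Longrightarrow> y \<le> z"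
  show "y \<le> m"
  proof (rule ccontr)
    assume "\<not> y \<le> m"
    then have "m < min y 0" using assms by auto
    then obtain r where r: "m < ereal r" "ereal r < min y 0" using ereal_dense2 by blast
    then have "r \<le> 0" by simp
    then have "ereal r \<le> 0" by simp
    from this assms(2) have "ereal r < p" by (rule le_less_trans)
    then show False using y[of "ereal r"] r by auto
  qed
qed auto

theorem theorem2p1:
  fixes M :: "'a measure" and X Y :: "'a \<Rightarrow> real"
    and J K :: nat and C D :: real and a b a' b' :: "nat \<Rightarrow> real"
    and F :: "complex \<Rightarrow> complex" and \<rho>p \<rho>m :: ereal
  assumes "prob_space M"
    and "X \<in> borel_measurable M" and "Y \<in> borel_measurable M"
    and "AE \<omega> in M. X \<omega> > 0" and "AE \<omega> in M. X \<omega> = exp (Y \<omega>)"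
    and "D > 0"
    and "\<forall>j\<in>{1..J}. a j \<noteq> 0" and "\<forall>k\<in>{1..K}. a' k \<noteq> 0"
    and F: "F = gamma_type_fun C D J a b K a' b'"
    and \<rho>p: "\<rho>p = rho_plus F" and \<rho>m: "\<rho>m = rho_minus F"
  shows
    "let i = (\<exists>I::real set. is_interval I \<and> (\<exists>u\<in>I. \<exists>v\<in>I. u < v) \<and>
                (\<forall>s\<in>I. power_moment_eq M X F (complex_of_real s)));
         ii = (\<forall>s. \<rho>m < ereal (Re s) \<and> ereal (Re s) < \<rho>p \<longrightarrow> power_moment_eq M X F s);
         iii = (\<exists>I::real set. is_interval I \<and> (\<exists>u\<in>I. \<exists>v\<in>I. u < v) \<and>
                (\<forall>s\<in>I. exp_moment_eq M Y F (complex_of_real s)));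
         iv = (\<forall>s. \<rho>m < ereal (Re s) \<and> ereal (Re s) < \<rho>p \<longrightarrow> exp_moment_eq M Y F s);
         v = (\<exists>t0>0. \<forall>t::real. t \<noteq> 0 \<and> \<bar>t\<bar> < t0 \<longrightarrow>
                exp_moment_eq M Y F (\<i> * complex_of_real t));
         vi = (\<forall>t::real. exp_moment_eq M Y F (\<i> * complex_of_real t))
     in (i \<longleftrightarrow> ii) \<and> (i \<longleftrightarrow> iii) \<and> (i \<longleftrightarrow> iv) \<and> (i \<longleftrightarrow> v) \<and> (i \<longleftrightarrow> vi) \<and>
        (i \<longrightarrow>
          (\<forall>s::real. ereal s \<le> \<rho>m \<or> \<rho>p \<le> ereal s \<longrightarrow>
             (\<integral>\<^sup>+\<omega>. ennreal (X \<omega> powr s) \<partial>M) = \<infinity> \<and>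
             (\<integral>\<^sup>+\<omega>. ennreal (exp (s * Y \<omega>)) \<partial>M) = \<infinity>) \<and>
          {s::real. (\<integral>\<^sup>+\<omega>. ennreal (X \<omega> powr s) \<partial>M) < \<infinity>} =
             {s. \<rho>m < ereal s \<and> ereal s < \<rho>p} \<and>
          {s::real. (\<integral>\<^sup>+\<omega>. ennreal (exp (s * Y \<omega>)) \<partial>M) < \<infinity>} =
             {s. \<rho>m < ereal s \<and> ereal s < \<rho>p} \<and>
          \<rho>p = Sup (ereal ` {s. s \<ge> 0 \<and> (\<integral>\<^sup>+\<omega>. ennreal (X \<omega> powr s) \<partial>M) < \<infinity>}) \<and>
          \<rho>m = Inf (ereal ` {s. s \<le> 0 \<and> (\<integral>\<^sup>+\<omega>. ennreal (X \<omega> powr s) \<partial>M) < \<infinity>}) \<and>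
          (\<forall>s. \<rho>m < ereal (Re s) \<and> ereal (Re s) < \<rho>p \<longrightarrow>
             power_moment_eq M X F s \<and> exp_moment_eq M Y F s \<and> F s \<noteq> 0))"
proof -
  interpret prob_space M by fact
  note XY_meas = assms(2,3) and Y = assms(3)
  have merom: "F nicely_meromorphic_on UNIV"
    unfolding F by (rule gamma_type_fun_nicely_meromorphic)
  \<comment> \<open>A pole at 0 is not counted by \<open>rho_plus\<close> or
    \<open>rho_minus\<close>, so 0 always lies strictly between them.\<close>
  have strip0: "\<rho>m < 0" "0 < \<rho>p"
    using rho_minus_ge_iff[OF merom, of 0] rho_plus_le_iff[OF merom, of 0]
    by (auto simp: \<rho>p \<rho>m not_le zero_ereal_def[symmetric])
  note pow_iff = power_moment_eq_iff_exp_moment_eq[OF XY_meas assms(5)]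
  have nn_eq: "(\<integral>\<^sup>+\<omega>. ennreal (X \<omega> powr s) \<partial>M) = (\<integral>\<^sup>+\<omega>. ennreal (exp (s * Y \<omega>)) \<partial>M)" for s
  proof (rule nn_integral_cong_AE)
    show "AE \<omega> in M. ennreal (X \<omega> powr s) = ennreal (exp (s * Y \<omega>))"
      using assms(5) by eventually_elim (simp add: powr_def)
  qed
  \<comment> \<open>\<open>P\<close> is the hub: each of the six conditions is reduced to it, the
    power versions through \<open>pow_iff\<close>.\<close>
  define P where "P \<longleftrightarrow> (\<exists>p. laplace_continuation M Y F p)"
  have dom: "s \<in> laplace_domain M Y \<longleftrightarrow> \<rho>m < ereal s \<and> ereal s < \<rho>p" if P for s
    using that unfolding P_def \<rho>p \<rho>m by (elim exE) (rule laplace_continuation.domain_eq)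
  have moment: "exp_moment_eq M Y F s" if P "\<rho>m < ereal (Re s)" "ereal (Re s) < \<rho>p" for s
  proof -
    have "Re s \<in> laplace_domain M Y" using that dom by simp
    with \<open>P\<close> show ?thesis
      unfolding P_def by (elim exE) (rule laplace_continuation.exp_moment_eq_in_strip)
  qed
  have iii: "(\<exists>I::real set. is_interval I \<and> (\<exists>u\<in>I. \<exists>v\<in>I. u < v) \<and>
                (\<forall>s\<in>I. exp_moment_eq M Y F (complex_of_real s))) \<longleftrightarrow> P" (is "?iii \<longleftrightarrow> P")
  proof
    assume ?iii
    then obtain I u v where I: "is_interval I" "u \<in> I" "v \<in> I" "u < v"
      "\<forall>s\<in>I. exp_moment_eq M Y F (of_real s)" by blast
    have "{u..v} \<subseteq> I" using mem_is_interval_1_I[OF I(1-3)] by auto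
    then show P
      unfolding P_def by (intro laplace_continuation_if_interval[OF assms(1) Y merom I(4)] I(5)[rule_format]) (rule subsetD)
  next
    assume P: P
    \<comment> \<open>The whole domain serves as the interval \<open>I\<close>; 0 and
      \<open>r\<close> show that it has positive length.\<close>
    obtain r where "0 < ereal r" "ereal r < \<rho>p" using ereal_dense2[OF strip0(2)] by auto
    then have "0 \<in> laplace_domain M Y" "r \<in> laplace_domain M Y" "0 < r"
      using strip0 less_trans[OF strip0(1), of "ereal r"] by (auto simp: dom[OF P] zero_ereal_def[symmetric])
    moreover have "exp_moment_eq M Y F (of_real s)" if "s \<in> laplace_domain M Y" for s
      using that moment[OF P, of "of_real s"] by (simp add: dom[OF P])
    ultimately show ?iii
      using is_interval_laplace_domain[OF Y] by blast
  qed
  have v: "(\<exists>t0>0. \<forall>t::real. t \<noteq> 0 \<and> \<bar>t\<bar> < t0 \<longrightarrow>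
                exp_moment_eq M Y F (\<i> * complex_of_real t)) \<Longrightarrow> P"
    unfolding P_def by (elim exE conjE) (rule laplace_continuation_if_imaginary[OF assms(1) Y merom], auto)
  have iv: "(\<forall>s. \<rho>m < ereal (Re s) \<and> ereal (Re s) < \<rho>p \<longrightarrow> exp_moment_eq M Y F s) \<longleftrightarrow> P" (is "?iv \<longleftrightarrow> P")
    and vi: "(\<forall>t::real. exp_moment_eq M Y F (\<i> * complex_of_real t)) \<longleftrightarrow> P" (is "?vi \<longleftrightarrow> P")
    and v': "(\<exists>t0>0. \<forall>t::real. t \<noteq> 0 \<and> \<bar>t\<bar> < t0 \<longrightarrow>
                exp_moment_eq M Y F (\<i> * complex_of_real t)) \<longleftrightarrow> P" (is "?v \<longleftrightarrow> P")
  proof -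
    \<comment> \<open>The cycle runs from \<open>P\<close> through (iv), (vi) and (v) back to
      \<open>P\<close>.\<close>
    have "P \<Longrightarrow> ?iv" using moment by blast
    moreover have "?iv \<Longrightarrow> ?vi" using strip0 by (auto simp: zero_ereal_def[symmetric])
    moreover have "?vi \<Longrightarrow> ?v" using zero_less_one by blast
    ultimately show "?iv \<longleftrightarrow> P" "?vi \<longleftrightarrow> P" "?v \<longleftrightarrow> P" using v by blast+
  qed
  have nonzero: "F s \<noteq> 0" if P: P and s: "\<rho>m < ereal (Re s)" "ereal (Re s) < \<rho>p" for s
  proof (cases "Im s = 0")
    case True
    then have real: "s = of_real (Re s)" by (simp add: complex_eq_iff)
    obtain x where "x > 0" "laplace_transform M Y (of_real (Re s)) = complex_of_real x"
      using laplace_transform_real_pos[OF assms(1), of "Re s" Y] s dom[OF P] by blast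
    moreover have "F s = laplace_transform M Y (of_real (Re s))"
      using moment[OF P s] by (simp add: exp_moment_eq_iff[OF Y] flip: real)
    ultimately show ?thesis by simp
  next
    case False
    have "C \<noteq> 0"
    proof
      assume "C = 0"
      then have "F 0 = 0" unfolding F by (simp add: gamma_type_fun_zero)
      moreover have "exp_moment_eq M Y F 0"
        using moment[OF P, of 0] strip0 by (simp add: zero_ereal_def[symmetric])
      ultimately show False
        using prob_space by (simp add: exp_moment_eq_iff[OF Y] laplace_transform_def)
    qed
    then show ?thesis
      unfolding F using False assms by (intro gamma_type_fun_nonreal_nonzero)
  qed
  have infinite: "(\<integral>\<^sup>+\<omega>. ennreal (exp (s * Y \<omega>)) \<partial>M) = \<infinity>" if P "ereal s \<le> \<rho>m \<or> \<rho>p \<le> ereal s" for s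
    using nn_integral_exp_less_top_iff[OF Y, of s] dom[OF that(1), of s] that(2)
    by (auto simp: less_top[symmetric])
  show ?thesis
    unfolding Let_def pow_iff nn_eq nn_integral_exp_less_top_iff[OF Y] iii iv v' vi
  proof (intro conjI impI allI refl)
    assume P: P
    have dom_P: "laplace_domain M Y = {s. \<rho>m < ereal s \<and> ereal s < \<rho>p}"
      using dom[OF P] by blast
    show "{s. s \<in> laplace_domain M Y} = {s. \<rho>m < ereal s \<and> ereal s < \<rho>p}"
      "{s. s \<in> laplace_domain M Y} = {s. \<rho>m < ereal s \<and> ereal s < \<rho>p}"
      "\<rho>p = Sup (ereal ` {s. 0 \<le> s \<and> s \<in> laplace_domain M Y})"
      "\<rho>m = Inf (ereal ` {s. s \<le> 0 \<and> s \<in> laplace_domain M Y})"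
      unfolding dom_P mem_Collect_eq
      using ereal_Sup_real_segment[OF strip0] ereal_Inf_real_segment[OF strip0] by (simp_all only:)
  qed (use infinite moment nonzero in blast)+
qed

end
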